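(* The $(4,4)$-spectrum consists of $8$ and all integers greater than or equal to $10$, that is, it equals $\{8,10,11,12,\dots\}$. In particular $n(4,4)=8<N(4,4)=10$.
   Context: Graphs are finite and simple. For integers $k\ge 3$, $g\ge 3$, a $(k,g)$-graph is a $k$-regular graph of girth exactly $g$. The $(k,g)$-spectrum is the set of all integers $n$ such that there exists a connected $(k,g)$-graph of order $n$. $n(k,g)$ denotes the smallest order of a $(k,g)$-graph. For even $k$, $N(k,g)$ denotes the smallest integer $N$ such that all integers $n\ge N$ belong to the $(k,g)$-spectrum. *)

theory Defs
  imports "Graph_Theory.Graph_Theory" "HOL-Library.Extended_Nat"
begin

text \<open>
  A finite simple graph is a \<^locale>\<open>pair_graph\<close>: each undirected edge is represented by the
  two arcs \<open>(u, v)\<close> and \<open>(v, u)\<close>, so the out-degree of a vertex is its degree.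
\<close>

definition regular :: "nat \<Rightarrow> 'a pair_pre_digraph \<Rightarrow> bool" where
  "regular k G \<longleftrightarrow> (\<forall>v \<in> pverts G. out_degree (with_proj G) v = k)"

text \<open>
  The bound on the length excludes the closed walks \<open>u, v, u\<close>, which the library counts as
  cycles of a symmetric digraph but which are not cycles of the undirected graph.
\<close>
definition undirected_cycle :: "'a pair_pre_digraph \<Rightarrow> ('a \<times> 'a) awalk \<Rightarrow> bool" where
  "undirected_cycle G p \<longleftrightarrow> pre_digraph.cycle (with_proj G) p \<and> 3 \<le> length p"

text \<open>The girth of an acyclic graph is \<open>\<infinity>\<close>, the infimum of the empty set.\<close>
definition girth :: "'a pair_pre_digraph \<Rightarrow> enat" where
  "girth G = (INF p \<in> {p. undirected_cycle G p}. enat (length p))"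

definition kg_graph :: "nat \<Rightarrow> nat \<Rightarrow> 'a pair_pre_digraph \<Rightarrow> bool" where
  "kg_graph k g G \<longleftrightarrow> pair_graph G \<and> regular k G \<and> girth G = enat g"

text \<open>
  Below, vertices are natural numbers; every finite graph is isomorphic to one of this kind.
\<close>

definition kg_spectrum :: "nat \<Rightarrow> nat \<Rightarrow> nat set" where
  "kg_spectrum k g =
     {n. \<exists>G :: nat pair_pre_digraph. kg_graph k g G \<and> connected (with_proj G) \<and> card (pverts G) = n}"

text \<open>Connectedness is not required here, in contrast to the spectrum.\<close>
definition min_order :: "nat \<Rightarrow> nat \<Rightarrow> nat" where
  "min_order k g = (LEAST n. \<exists>G :: nat pair_pre_digraph. kg_graph k g G \<and> card (pverts G) = n)"

definition spectrum_threshold :: "nat \<Rightarrow> nat \<Rightarrow> nat" where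
  "spectrum_threshold k g = (LEAST N. \<forall>n \<ge> N. n \<in> kg_spectrum k g)"

end

theory Submission
  imports Defs
begin

text \<open>
  Let \<open>u, v\<close> be adjacent in a 4-regular graph of girth 4. There are no triangles, so the
  neighbourhoods of \<open>u\<close> and \<open>v\<close> are disjoint and the graph has at least 8 vertices. If it had 9,
  there would be exactly one vertex \<open>w\<close> outside the two neighbourhoods, and the 4 neighbours of
  \<open>w\<close> would be split between them. No part is empty, since \<open>w\<close> is adjacent to neither \<open>u\<close> nor
  \<open>v\<close>, which leaves only three candidates on each side. A neighbour \<open>a\<close> of \<open>w\<close> on the side of
  \<open>u\<close> has two further neighbours, and as they can lie neither in the neighbourhood of \<open>u\<close> nor in
  that of \<open>w\<close>, they use up all but two members of the neighbourhood of \<open>v\<close>, one of which is \<open>u\<close>.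
  So \<open>w\<close> has at most one neighbour on the side of \<open>v\<close>, and symmetrically at most one on the
  side of \<open>u\<close>, which contradicts its degree (\<open>four_regular_order\<close>).

  All other orders are realised by one family, the circulant graph on \<open>\<int>/n\<close> with steps \<open>\<plusminus>1\<close> and
  \<open>\<plusminus>3\<close>. A triangle in it amounts to three steps whose sum is divisible by \<open>n\<close>. Such a sum is odd
  and at most 9 in absolute value, hence it is divisible neither by 8 nor by any \<open>n \<ge> 10\<close>, while
  \<open>3 + 3 + 3\<close> closes up modulo 9. The 4-cycle \<open>0, 1, 2, 3\<close> shows that the girth is exactly 4.
\<close>

section \<open>Girth four\<close>

definition triangle_free :: "'a pair_pre_digraph \<Rightarrow> bool" where
  "triangle_free G \<longleftrightarrow>
     (\<forall>a b c. (a, b) \<in> parcs G \<longrightarrow> (b, c) \<in> parcs G \<longrightarrow> (c, a) \<notin> parcs G)"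

definition neighbours :: "'a pair_pre_digraph \<Rightarrow> 'a \<Rightarrow> 'a set" where
  "neighbours G v = {w. (v, w) \<in> parcs G}"

lemma out_degree_eq_card_neighbours: "out_degree (with_proj G) v = card (neighbours G v)"
proof -
  have "out_arcs (with_proj G) v = Pair v ` neighbours G v"
    by (auto simp: out_arcs_def neighbours_def)
  then show ?thesis
    unfolding out_degree_def by (simp add: card_image inj_on_def)
qed

lemma (in pair_graph) triangle_free_if_girth_gt_3:
  assumes "girth G > 3"
  shows "triangle_free G"
  unfolding triangle_free_def
proof (intro allI impI notI)
  fix a b c assume arcs: "(a, b) \<in> parcs G" "(b, c) \<in> parcs G" "(c, a) \<in> parcs G"
  then have "a \<noteq> b" "b \<noteq> c" "c \<noteq> a" "a \<in> pverts G"
    by (auto dest: pair_no_loops arc_fst_in_verts)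
  with arcs have "undirected_cycle G [(a, b), (b, c), (c, a)]"
    by (auto simp: undirected_cycle_def cycle_def awalk_def)
  then have "girth G \<le> enat (length [(a, b), (b, c), (c, a)])"
    unfolding girth_def by (intro INF_lower) simp
  then show False using assms by (simp add: numeral_eq_enat numeral_3_eq_3)
qed

lemma (in pair_graph) girth_eq_4_if_square:
  assumes "triangle_free G" and "distinct [a, b, c, d]"
    and "(a, b) \<in> parcs G" "(b, c) \<in> parcs G" "(c, d) \<in> parcs G" "(d, a) \<in> parcs G"
  shows "girth G = enat 4"
proof (rule antisym)
  have "a \<in> pverts G" using arc_fst_in_verts[OF assms(3)] by simp
  with assms have "undirected_cycle G [(a, b), (b, c), (c, d), (d, a)]"
    by (auto simp: undirected_cycle_def cycle_def awalk_def)
  then have "girth G \<le> enat (length [(a, b), (b, c), (c, d), (d, a)])"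
    unfolding girth_def by (intro INF_lower) simp
  then show "girth G \<le> enat 4" by (simp add: numeral_eq_Suc)
next
  have "4 \<le> length p" if cyc: "undirected_cycle G p" for p
  proof (rule ccontr)
    assume "\<not> 4 \<le> length p"
    with cyc have "length p = 3" by (auto simp: undirected_cycle_def)
    then obtain e f g where "p = [e, f, g]"
      by (auto simp: numeral_3_eq_3 length_Suc_conv)
    with cyc have "set [e, f, g] \<subseteq> parcs G" "snd e = fst f" "snd f = fst g" "snd g = fst e"
      by (auto simp: undirected_cycle_def cycle_def awalk_def)
    moreover from this have "e = (fst e, snd e)" "f = (snd e, snd f)" "g = (snd f, fst e)"
      by (simp_all add: prod_eq_iff)
    ultimately have "(fst e, snd e) \<in> parcs G" "(snd e, snd f) \<in> parcs G" "(snd f, fst e) \<in> parcs G"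
      by (metis list.set_intros subsetD)+
    then show False using assms(1) unfolding triangle_free_def by blast
  qed
  then show "enat 4 \<le> girth G"
    unfolding girth_def by (intro INF_greatest) simp
qed

lemma ex_arc_if_girth_finite:
  assumes "girth G = enat g"
  shows "\<exists>u v. (u, v) \<in> parcs G"
proof -
  have "\<exists>p. undirected_cycle G p"
  proof (rule ccontr)
    assume "\<nexists>p. undirected_cycle G p"
    then have "girth G = \<infinity>" by (simp add: girth_def top_enat_def)
    with assms show False by simp
  qed
  then obtain p where "undirected_cycle G p" ..
  then have "set p \<subseteq> parcs G" "p \<noteq> []"
    by (auto simp: undirected_cycle_def pre_digraph.cycle_def pre_digraph.awalk_def)
  then show ?thesis by (cases p) auto
qed

section \<open>Orders of 4-regular triangle-free graphs\<close>

context pair_graph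
begin

lemma neighbours_subset: "neighbours G v \<subseteq> pverts G"
  by (auto simp: neighbours_def dest: arc_snd_in_verts)

lemma finite_neighbours: "finite (neighbours G v)"
  using neighbours_subset pair_finite_verts by (rule finite_subset)

lemma neighbours_sym: "w \<in> neighbours G v \<longleftrightarrow> v \<in> neighbours G w"
  using pair_sym_arcs by (auto simp: neighbours_def symmetric_def dest: symD)

lemma disjoint_neighbours:
  assumes "triangle_free G" "v \<in> neighbours G u"
  shows "neighbours G u \<inter> neighbours G v = {}"
  using assms neighbours_sym unfolding triangle_free_def neighbours_def by blast

text \<open>
  The neighbours of \<open>a\<close> other than \<open>u\<close> and \<open>w\<close> lie in \<open>N(v)\<close>, but not in \<open>N(w)\<close>. There are
  at least two of them, and the four elements of \<open>N(v)\<close> also include \<open>u\<close>, so at most one place is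
  left for \<open>N(w)\<close>.
\<close>
lemma card_common_neighbours_le_1:
  assumes tf: "triangle_free G"
    and deg: "\<And>x. x \<in> pverts G \<Longrightarrow> card (neighbours G x) = 4"
    and verts: "pverts G = insert w (neighbours G u \<union> neighbours G v)"
    and uv: "v \<in> neighbours G u" and w: "w \<notin> neighbours G u"
    and a: "a \<in> neighbours G w" "a \<in> neighbours G u"
  shows "card (neighbours G w \<inter> neighbours G v) \<le> 1"
proof -
  let ?W = "neighbours G w \<inter> neighbours G v" and ?A = "neighbours G a - {u, w}"
  note fin = finite_neighbours
  have "a \<in> pverts G" "v \<in> pverts G" using a uv neighbours_subset by auto
  then have card4: "card (neighbours G a) = 4" "card (neighbours G v) = 4" using deg by auto
  have u_v: "u \<in> neighbours G v" using uv neighbours_sym by blast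
  have "u \<notin> neighbours G w" using w neighbours_sym by blast
  have disj: "neighbours G u \<inter> neighbours G a = {}" "neighbours G w \<inter> neighbours G a = {}"
    using disjoint_neighbours[OF tf] a by auto
  have "?A \<subseteq> neighbours G v"
    using neighbours_subset[of a] verts disj by blast
  then have "?A \<union> ?W \<union> {u} \<subseteq> neighbours G v" using u_v by auto
  then have "card (?A \<union> ?W \<union> {u}) \<le> 4"
    using card4 fin by (metis card_mono)
  moreover have "card (?A \<union> ?W \<union> {u}) = card ?A + card ?W + 1"
    using fin disj \<open>u \<notin> neighbours G w\<close> by (subst card_Un_disjoint; auto simp: card_Un_disjoint)+
  moreover have "card ?A \<ge> 2"
    using diff_card_le_card_Diff[of "{u, w}" "neighbours G a"] card4 card_insert_le_m1[of 2 "{w}" u]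
    by (cases "u = w") auto
  ultimately show ?thesis by linarith
qed

lemma four_regular_order:
  assumes tf: "triangle_free G"
    and deg: "\<And>x. x \<in> pverts G \<Longrightarrow> card (neighbours G x) = 4"
    and arc: "(u, v) \<in> parcs G"
  shows "card (pverts G) \<ge> 8" and "card (pverts G) \<noteq> 9"
proof -
  let ?S = "neighbours G u \<union> neighbours G v"
  note fin = finite_neighbours
  have uv: "v \<in> neighbours G u" "u \<in> neighbours G v"
    using arc neighbours_sym by (auto simp: neighbours_def)
  have "u \<in> pverts G" "v \<in> pverts G" using uv neighbours_subset by auto
  then have card4: "card (neighbours G u) = 4" "card (neighbours G v) = 4"
    using deg by auto
  have cardS: "card ?S = 8"
    using disjoint_neighbours[OF tf uv(1)] card4 fin by (simp add: card_Un_disjoint)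
  have S: "?S \<subseteq> pverts G" using neighbours_subset by auto
  then show "card (pverts G) \<ge> 8" using cardS card_mono[OF pair_finite_verts S] by simp
  show "card (pverts G) \<noteq> 9"
  proof
    assume "card (pverts G) = 9"
    then have "card (pverts G - ?S) = 1" using S cardS fin by (simp add: card_Diff_subset)
    then obtain w where w: "pverts G - ?S = {w}" by (auto simp: card_1_singleton_iff)
    then have verts: "pverts G = insert w ?S" using S by auto
    let ?U = "neighbours G w \<inter> neighbours G u" and ?V = "neighbours G w \<inter> neighbours G v"
    have w_notin: "w \<notin> neighbours G u" "w \<notin> neighbours G v" using w by auto
    then have notin_w: "u \<notin> neighbours G w" "v \<notin> neighbours G w" using neighbours_sym by auto
    have "w \<notin> neighbours G w" using pair_no_loops by (fastforce simp: neighbours_def)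
    moreover have "neighbours G w \<subseteq> insert w ?S" using verts neighbours_subset by metis
    ultimately have "neighbours G w \<subseteq> ?S" by blast
    then have "neighbours G w = ?U \<union> ?V" by blast
    moreover have "card (neighbours G w) = 4" using deg verts by auto
    ultimately have "card (?U \<union> ?V) = 4" by metis
    then have sum: "card ?U + card ?V \<ge> 4" by (metis card_Un_le)
    have "?U \<subseteq> neighbours G u - {v}" "?V \<subseteq> neighbours G v - {u}" using notin_w by auto
    then have "card ?U \<le> card (neighbours G u - {v})" "card ?V \<le> card (neighbours G v - {u})"
      using fin by (auto intro!: card_mono)
    then have "card ?U \<le> 3" "card ?V \<le> 3" using card4 uv by auto
    with sum have "card ?U \<noteq> 0" "card ?V \<noteq> 0" by linarith+
    then obtain a b where "a \<in> ?U" "b \<in> ?V" by (metis card.empty equals0I)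
    have "pverts G = insert w (neighbours G v \<union> neighbours G u)" using verts by auto
    then have "card ?V \<le> 1" "card ?U \<le> 1"
      using card_common_neighbours_le_1[OF tf deg verts uv(1) w_notin(1), of a]
        card_common_neighbours_le_1[OF tf deg _ uv(2) w_notin(2), of b] \<open>a \<in> ?U\<close> \<open>b \<in> ?V\<close>
      by auto
    with sum show False by linarith
  qed
qed

end

lemma kg_4_4_order:
  assumes "kg_graph 4 4 G"
  shows "card (pverts G) = 8 \<or> card (pverts G) \<ge> 10"
proof -
  interpret pair_graph G using assms by (simp add: kg_graph_def)
  have girth: "girth G = enat 4" using assms by (simp add: kg_graph_def)
  then have "triangle_free G" by (intro triangle_free_if_girth_gt_3) (simp add: numeral_eq_enat)
  moreover obtain u v where "(u, v) \<in> parcs G" using ex_arc_if_girth_finite[OF girth] by blast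
  moreover have "card (neighbours G x) = 4" if "x \<in> pverts G" for x
    using assms that by (simp add: kg_graph_def regular_def out_degree_eq_card_neighbours)
  ultimately have "card (pverts G) \<ge> 8" "card (pverts G) \<noteq> 9"
    using four_regular_order by blast+
  then show ?thesis by linarith
qed

section \<open>Circulant graphs with steps 1 and 3\<close>

definition steps :: "int set" where
  "steps = {1, 3, -1, -3}"

text \<open>
  Stating adjacency as a divisibility of differences lets the differences around a triangle
  telescope.
\<close>
definition circulant :: "nat \<Rightarrow> nat pair_pre_digraph" where
  "circulant n = \<lparr> pverts = {..<n},
     parcs = {(i, j). i < n \<and> j < n \<and> (\<exists>d \<in> steps. int n dvd int j - int i - d)} \<rparr>"

lemma pverts_circulant [simp]: "pverts (circulant n) = {..<n}"
  by (simp add: circulant_def)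

lemma circulant_arcI:
  assumes "i < n" "j < n" "int j - int i \<in> steps"
  shows "(i, j) \<in> parcs (circulant n)"
  using assms by (auto simp: circulant_def intro!: bexI[of _ "int j - int i"])

lemma circulant_arcE:
  assumes "(i, j) \<in> parcs (circulant n)"
  obtains d where "i < n" "j < n" "d \<in> steps" "int n dvd int j - int i - d"
  using assms by (auto simp: circulant_def)

lemma circulant_arc_sym:
  assumes "(i, j) \<in> parcs (circulant n)"
  shows "(j, i) \<in> parcs (circulant n)"
proof -
  from assms obtain d where d: "i < n" "j < n" "d \<in> steps" "int n dvd int j - int i - d"
    by (rule circulant_arcE)
  then have "int n dvd int i - int j - (- d)"
    by (subst dvd_minus_iff[symmetric]) (simp add: algebra_simps)
  with d show ?thesis by (auto simp: circulant_def steps_def)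
qed

lemma pair_graph_circulant:
  assumes "n > 3"
  shows "pair_graph (circulant n)"
proof
  have "parcs (circulant n) \<subseteq> {..<n} \<times> {..<n}" by (auto simp: circulant_def)
  then show "finite (parcs (circulant n))" by (rule finite_subset) simp
  show "symmetric (with_proj (circulant n))"
    using circulant_arc_sym by (auto simp: symmetric_def intro!: symI)
next
  fix e assume "e \<in> parcs (circulant n)"
  moreover have "\<not> int n dvd d" if "d \<in> steps" for d
    using zdvd_not_zless[of "\<bar>d\<bar>" "int n"] that assms by (auto simp: steps_def)
  ultimately show "fst e \<noteq> snd e" by (cases e) (auto elim!: circulant_arcE)
qed (auto simp: circulant_def)

lemma neighbours_circulant:
  assumes "i < n"
  shows "neighbours (circulant n) i = (\<lambda>d. nat ((int i + d) mod int n)) ` steps"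
proof (intro set_eqI iffI)
  fix j assume "j \<in> neighbours (circulant n) i"
  then have "(i, j) \<in> parcs (circulant n)" by (simp add: neighbours_def)
  then obtain d where d: "j < n" "d \<in> steps" "int n dvd int j - (int i + d)"
    by (auto elim!: circulant_arcE simp: algebra_simps)
  then have "(int i + d) mod int n = int j mod int n"
    by (metis mod_eq_dvd_iff)
  also have "\<dots> = int j" using d by simp
  finally show "j \<in> (\<lambda>d. nat ((int i + d) mod int n)) ` steps" using d by force
next
  fix j assume "j \<in> (\<lambda>d. nat ((int i + d) mod int n)) ` steps"
  then obtain d where d: "d \<in> steps" "int j = (int i + d) mod int n"
    using assms by auto
  then have "int n dvd int j - (int i + d)"
    by (metis mod_eq_dvd_iff mod_mod_trivial)
  moreover have "int j < int n" unfolding d(2) using assms by simp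
  then have "j < n" by simp
  ultimately show "j \<in> neighbours (circulant n) i"
    using d(1) assms by (auto simp: neighbours_def circulant_def diff_diff_add)
qed

lemma card_neighbours_circulant:
  assumes "i < n" "n > 6"
  shows "card (neighbours (circulant n) i) = 4"
proof -
  have "inj_on (\<lambda>d. nat ((int i + d) mod int n)) steps"
  proof (rule inj_onI)
    fix d e
    assume de: "d \<in> steps" "e \<in> steps"
      and "nat ((int i + d) mod int n) = nat ((int i + e) mod int n)"
    then have "(int i + d) mod int n = (int i + e) mod int n"
      using assms by (simp add: eq_nat_nat_iff)
    then have "int n dvd d - e" by (simp add: mod_eq_dvd_iff)
    moreover have "\<bar>d - e\<bar> < int n" using de assms by (auto simp: steps_def)
    ultimately show "d = e" using dvd_imp_le_int[of "d - e" "int n"] by auto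
  qed
  then show ?thesis
    by (simp add: neighbours_circulant[OF assms(1)] card_image steps_def)
qed

lemma triangle_free_circulant:
  assumes "n = 8 \<or> n \<ge> 10"
  shows "triangle_free (circulant n)"
  unfolding triangle_free_def
proof (intro allI impI notI)
  fix a b c
  assume "(a, b) \<in> parcs (circulant n)" "(b, c) \<in> parcs (circulant n)"
    "(c, a) \<in> parcs (circulant n)"
  then obtain d e f where steps: "d \<in> steps" "e \<in> steps" "f \<in> steps"
    and dvd: "int n dvd int b - int a - d" "int n dvd int c - int b - e"
      "int n dvd int a - int c - f"
    by (auto elim!: circulant_arcE)
  have "int n dvd (int b - int a - d) + (int c - int b - e) + (int a - int c - f)"
    using dvd by (intro dvd_add)
  also have "\<dots> = - (d + e + f)" by simp
  finally have n: "int n dvd d + e + f" by (simp only: dvd_minus_iff)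
  have odd: "odd (d + e + f)" and le: "\<bar>d + e + f\<bar> \<le> 9"
    using steps by (auto simp: steps_def)
  show False
  proof (cases "n = 8")
    case True
    then have "even (int n)" by simp
    with n odd show False using dvd_trans by blast
  next
    case False
    have "d + e + f \<noteq> 0" using odd by (metis even_zero)
    with n have "int n \<le> \<bar>d + e + f\<bar>" using dvd_imp_le_int[of "d + e + f" "int n"] by simp
    with False assms le show False by linarith
  qed
qed

lemma connected_circulant:
  assumes "n > 0"
  shows "connected (with_proj (circulant n))"
proof -
  let ?R = "rtrancl_on {..<n} ((parcs (circulant n))\<^sup>s)"
  have from_0: "i < n \<Longrightarrow> (0, i) \<in> ?R" for i
  proof (induction i)
    case 0
    then show ?case using assms by auto
  next
    case (Suc i)
    then have "(i, Suc i) \<in> parcs (circulant n)" by (intro circulant_arcI) (auto simp: steps_def)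
    then have "(i, Suc i) \<in> (parcs (circulant n))\<^sup>s" by (auto simp: symcl_def)
    with Suc show ?case by (auto intro: rtrancl_on_into_rtrancl_on)
  qed
  have "sym ?R" by (intro rtrancl_on_sym) (auto simp: symcl_def sym_def)
  with from_0 have "(i, j) \<in> ?R" if "i < n" "j < n" for i j
    using that by (meson rtrancl_on_trans symD)
  then show ?thesis using assms by (auto simp: connected_conv)
qed

lemma kg_graph_circulant:
  assumes "n = 8 \<or> n \<ge> 10"
  shows "kg_graph 4 4 (circulant n)"
proof -
  have n: "n > 6" using assms by linarith
  have graph: "pair_graph (circulant n)" using n by (intro pair_graph_circulant) simp
  have "girth (circulant n) = enat 4"
  proof (rule pair_graph.girth_eq_4_if_square[OF graph triangle_free_circulant[OF assms]])
    show "distinct [0, 1, 2, 3 :: nat]" by simp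
    show "(0, 1) \<in> parcs (circulant n)" "(1, 2) \<in> parcs (circulant n)"
      "(2, 3) \<in> parcs (circulant n)" "(3, 0) \<in> parcs (circulant n)"
      using n by (simp_all add: circulant_arcI steps_def)
  qed
  moreover have "regular 4 (circulant n)"
    using n unfolding regular_def out_degree_eq_card_neighbours pverts_circulant
    by (simp add: card_neighbours_circulant)
  ultimately show ?thesis using graph by (simp add: kg_graph_def)
qed

lemma kg_spectrum_4_4: "kg_spectrum 4 4 = {8} \<union> {n. n \<ge> 10}"
proof (intro set_eqI iffI)
  fix n assume "n \<in> kg_spectrum 4 4"
  then obtain G :: "nat pair_pre_digraph" where "kg_graph 4 4 G" "card (pverts G) = n"
    unfolding kg_spectrum_def by blast
  then show "n \<in> {8} \<union> {n. n \<ge> 10}" using kg_4_4_order[of G] by simp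
next
  fix n :: nat assume "n \<in> {8} \<union> {n. n \<ge> 10}"
  then have "n = 8 \<or> n \<ge> 10" by auto
  then have "kg_graph 4 4 (circulant n)" "connected (with_proj (circulant n))"
    using kg_graph_circulant connected_circulant by auto
  moreover have "card (pverts (circulant n)) = n" by simp
  ultimately show "n \<in> kg_spectrum 4 4" unfolding kg_spectrum_def
    by (intro CollectI exI[of _ "circulant n"] conjI)
qed

theorem mainTheorem9:
  shows "kg_spectrum 4 4 = {8} \<union> {n. n \<ge> 10}
    \<and> min_order 4 4 = 8 \<and> min_order 4 4 < spectrum_threshold 4 4 \<and> spectrum_threshold 4 4 = 10"
proof -
  have "min_order 4 4 = 8"
    unfolding min_order_def
  proof (rule Least_equality)
    show "\<exists>G :: nat pair_pre_digraph. kg_graph 4 4 G \<and> card (pverts G) = 8"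
      using kg_graph_circulant[of 8] by (intro exI[of _ "circulant 8"]) simp
  next
    fix n assume "\<exists>G :: nat pair_pre_digraph. kg_graph 4 4 G \<and> card (pverts G) = n"
    then obtain G :: "nat pair_pre_digraph" where "kg_graph 4 4 G" "card (pverts G) = n"
      by blast
    then show "8 \<le> n" using kg_4_4_order[of G] by linarith
  qed
  moreover have "spectrum_threshold 4 4 = 10"
    unfolding spectrum_threshold_def
  proof (rule Least_equality)
    show "\<forall>n\<ge>10. n \<in> kg_spectrum 4 4" by (simp add: kg_spectrum_4_4)
  next
    fix N assume "\<forall>n\<ge>N. n \<in> kg_spectrum 4 4"
    then have "\<not> N \<le> 9" by (auto simp: kg_spectrum_4_4 dest!: spec[of _ 9])
    then show "10 \<le> N" by simp
  qed
  ultimately show ?thesis using kg_spectrum_4_4 by simp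
qed

end
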